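(* Let $A = \{a_k\}_{k=1}^\infty$ be a sequence of natural numbers. Suppose there exists an integer $s$ such that (1) $a_k > a_{k-1} + a_{k-3}$ for all $k \ge s$, and (2) $A$ contains no special MSTD set. Then $A$ contains at most finitely many MSTD sets.
   Context: For a finite set $S$ of integers, $S+S = \{x+y : x,y \in S\}$ and $S-S = \{x-y : x,y\in S\}$. A finite set $S$ of integers is an MSTD (More Sums Than Differences) set if $|S+S| > |S-S|$. An MSTD set $S$ is called special if $|S+S| - |S-S| \ge |S|$. "$A$ contains a set $S$" means $S$ is a finite subset of the set of terms $\{a_k : k\ge 1\}$. Natural numbers are the nonnegative integers. *)

theory Defs
  imports Main
begin

definition sumset :: "int set \<Rightarrow> int set" where
  "sumset S = {x + y | x y. x \<in> S \<and> y \<in> S}"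

(* The Minkowski difference; S - S in HOL is set difference. *)
definition diffset :: "int set \<Rightarrow> int set" where
  "diffset S = {x - y | x y. x \<in> S \<and> y \<in> S}"

definition MSTD :: "int set \<Rightarrow> bool" where
  "MSTD S \<longleftrightarrow> finite S \<and> card (sumset S) > card (diffset S)"

(* Cardinalities are cast to int because subtraction on nat truncates. *)
definition special_MSTD :: "int set \<Rightarrow> bool" where
  "special_MSTD S \<longleftrightarrow>
     MSTD S \<and> int (card (sumset S)) - int (card (diffset S)) \<ge> int (card S)"

(* A sequence a_1, a_2, ... is a function on nat whose value at 0 is ignored. *)
definition seq_terms :: "(nat \<Rightarrow> nat) \<Rightarrow> int set" where
  "seq_terms a = {int (a k) | k. k \<ge> 1}"

end

theory Submission
  imports Defs
begin

text \<open>
  Build a set by inserting its elements in increasing order and follow the excess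
  \<open>|S + S| - |S - S|\<close>. If \<open>N\<close> of the differences \<open>x - y\<close> are old when a new maximum \<open>x\<close> is inserted
  into \<open>S\<close>, and \<open>M\<close> of the sums \<open>x + y\<close> are old, then the excess changes by at most
  \<open>1 - |S| - M + 2 N\<close>, and \<open>N > 0\<close> forces \<open>M > 0\<close>. The growth condition gives \<open>N \<le> 2\<close> in the tail of the
  sequence: only \<open>a\<^bsub>k-1\<^esub>\<close> and \<open>a\<^bsub>k-2\<^esub>\<close> can yield old differences with \<open>a\<^sub>k\<close>.
  Hence tail elements never raise the excess of a set of size at least 4 and lower it from size 6 on,
  while sets of size at most 4 have no positive excess at all. So an MSTD set contains a bounded
  number of tail elements. Moreover, a tail element \<open>x\<close> exceeding twice its predecessor in \<open>S\<close>
  produces only new differences, which lowers the excess by \<open>|S| - 1\<close>; as the smaller set is not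
  special, the excess is then nonpositive and stays so. Thus each tail element is at most twice its
  predecessor, and all elements are bounded.
\<close>

section \<open>Excess and its change when a new maximum is inserted\<close>

definition excess :: "int set \<Rightarrow> int" where
  "excess S = int (card (sumset S)) - int (card (diffset S))"

lemma finite_sumset: "finite S \<Longrightarrow> finite (sumset S)"
proof -
  assume "finite S"
  have "sumset S = (\<lambda>(x, y). x + y) ` (S \<times> S)"
    by (auto simp: sumset_def)
  with \<open>finite S\<close> show ?thesis by simp
qed

lemma finite_diffset: "finite S \<Longrightarrow> finite (diffset S)"
proof -
  assume "finite S"
  have "diffset S = (\<lambda>(x, y). x - y) ` (S \<times> S)"
    by (auto simp: diffset_def)
  with \<open>finite S\<close> show ?thesis by simp
qed

lemma diffset_minus_commute: "x - y \<in> diffset S \<longleftrightarrow> y - x \<in> diffset S"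
  unfolding diffset_def by (smt (verit, best) mem_Collect_eq)

text \<open>Writing M and N for the two sets counted, the only possible new sums are
  \<open>x + x\<close> and \<open>x + y\<close> with \<open>y\<close> in \<open>S\<close> outside M.
  Each \<open>y\<close> in \<open>S\<close> outside N gives two new differences \<open>x - y\<close>
  and \<open>y - x\<close>, distinct because their signs differ.\<close>

lemma excess_insert_le:
  assumes fin: "finite S" and less: "\<And>y. y \<in> S \<Longrightarrow> y < x"
  shows "excess (insert x S) \<le> excess S + 1 - int (card S)
           - int (card {y \<in> S. x + y \<in> sumset S}) + 2 * int (card {y \<in> S. x - y \<in> diffset S})"
proof -
  define M where "M = {y \<in> S. x + y \<in> sumset S}"
  define N where "N = {y \<in> S. x - y \<in> diffset S}"
  have sub: "M \<subseteq> S" "N \<subseteq> S" by (auto simp: M_def N_def)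
  have "sumset (insert x S) \<subseteq> sumset S \<union> ((+) x ` (S - M) \<union> {x + x})"
    by (auto simp: sumset_def M_def add.commute)
  then have "card (sumset (insert x S)) \<le> card (sumset S \<union> ((+) x ` (S - M) \<union> {x + x}))"
    using fin finite_sumset by (intro card_mono) auto
  also have "\<dots> \<le> card (sumset S) + (card ((+) x ` (S - M)) + card {x + x})"
    by (meson add_left_mono card_Un_le order_trans)
  also have "\<dots> \<le> card (sumset S) + (card (S - M) + 1)"
    using fin by (simp add: card_image_le)
  finally have sums: "card (sumset (insert x S)) \<le> card (sumset S) + (card (S - M) + 1)" .
  let ?P = "(\<lambda>y. x - y) ` (S - N)" and ?Q = "(\<lambda>y. y - x) ` (S - N)"
  have cP: "card ?P = card (S - N)" by (intro card_image) (auto simp: inj_on_def)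
  have cQ: "card ?Q = card (S - N)" by (intro card_image) (auto simp: inj_on_def)
  have PQ: "?P \<inter> ?Q = {}" proof -
    have "x - y \<noteq> z - x" if "y \<in> S" "z \<in> S" for y z
      using less[OF that(1)] less[OF that(2)] by linarith
    then show ?thesis by auto
  qed
  have D: "diffset S \<inter> (?P \<union> ?Q) = {}"
    using diffset_minus_commute by (auto simp: N_def)
  have "card (diffset S) + (card (S - N) + card (S - N)) = card (diffset S \<union> (?P \<union> ?Q))"
    using fin finite_diffset cP cQ PQ D by (simp add: card_Un_disjoint)
  also have "\<dots> \<le> card (diffset (insert x S))"
    using fin by (intro card_mono finite_diffset) (auto simp: diffset_def)
  finally have diffs: "card (diffset S) + (card (S - N) + card (S - N)) \<le> card (diffset (insert x S))" .
  have "card (S - M) = card S - card M" "card M \<le> card S"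
    "card (S - N) = card S - card N" "card N \<le> card S"
    using sub fin by (auto simp: card_Diff_subset card_mono finite_subset)
  with sums diffs show ?thesis
    unfolding excess_def M_def[symmetric] N_def[symmetric] by linarith
qed

text \<open>An old difference \<open>x - y = u - v\<close> makes the sum \<open>x + v = y + u\<close> old.\<close>

lemma old_sums_nonempty:
  assumes "finite S" "card {y \<in> S. x - y \<in> diffset S} > 0"
  shows "card {y \<in> S. x + y \<in> sumset S} > 0"
proof -
  obtain y u v where "y \<in> S" "u \<in> S" "v \<in> S" "x - y = u - v"
    using assms(2) by (auto simp: card_gt_0_iff diffset_def)
  then have "x + v = y + u" by simp
  then have "x + v \<in> sumset S"
    using \<open>y \<in> S\<close> \<open>u \<in> S\<close> by (auto simp: sumset_def)
  with \<open>v \<in> S\<close> assms(1) show ?thesis by (auto simp: card_gt_0_iff)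
qed

section \<open>Sets of at most four elements\<close>

lemma excess_empty: "excess {} = 0"
  by (simp add: excess_def sumset_def diffset_def)

lemma excess_singleton: "excess {x} = 0"
  by (simp add: excess_def sumset_def diffset_def)

lemma excess_pair_le:
  assumes "p < q"
  shows "excess {p, q} \<le> 0"
proof -
  have "{y \<in> {p}. q - y \<in> diffset {p}} = {}"
    using assms by (auto simp: diffset_def)
  then have "card {y \<in> {p}. q - y \<in> diffset {p}} = 0" by (simp only: card.empty)
  moreover have "excess {p, q} = excess (insert q {p})" by (simp add: insert_commute)
  moreover have "card {p} = 1" by simp
  moreover have "excess (insert q {p}) \<le> excess {p} + 1 - int (card {p})
      - int (card {y \<in> {p}. q + y \<in> sumset {p}}) + 2 * int (card {y \<in> {p}. q - y \<in> diffset {p}})"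
    by (rule excess_insert_le) (use assms in auto)
  ultimately show ?thesis
    using excess_singleton[of p] by linarith
qed

text \<open>Since \<open>r - p\<close> exceeds every old difference, only \<open>q\<close> can give
  an old difference with \<open>r\<close>, and then the triple is an arithmetic progression. The
  strict bound for other triples serves the case of four elements.\<close>

lemma excess_triple_le:
  assumes "p < q" "q < r"
  shows "excess {p, q, r} \<le> 0" and "r - q \<noteq> q - p \<Longrightarrow> excess {p, q, r} \<le> -1"
proof -
  let ?S = "{p, q}"
  let ?N = "{y \<in> ?S. r - y \<in> diffset ?S}"
  have ins: "{p, q, r} = insert r ?S" by auto
  have e: "excess {p, q, r} \<le> 0 + 1 - 2 - int (card {y \<in> ?S. r + y \<in> sumset ?S}) + 2 * int (card ?N)"
  proof -
    have "card ?S = 2" using assms by simp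
    moreover have "y < r" if "y \<in> ?S" for y using that assms by auto
    ultimately show ?thesis
      unfolding ins using excess_insert_le[of ?S r] excess_pair_le[OF assms(1)] by fastforce
  qed
  have N: "?N \<subseteq> {q}" using assms by (auto simp: diffset_def)
  then have c: "card ?N \<le> 1" using card_mono[of "{q}" ?N] by simp
  show "excess {p, q, r} \<le> 0"
  proof -
    have "card ?N > 0 \<Longrightarrow> card {y \<in> ?S. r + y \<in> sumset ?S} > 0"
      by (rule old_sums_nonempty) auto
    then show ?thesis using e c by linarith
  qed
  assume "r - q \<noteq> q - p"
  then have "?N = {}" using assms by (auto simp: diffset_def)
  then have "card ?N = 0" by (simp only: card.empty)
  then show "excess {p, q, r} \<le> -1" using e by linarith
qed

text \<open>Only \<open>q\<close> and \<open>r\<close> can give old differences with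
  \<open>x\<close>. If both do, the insertion bound falls short by one; the missing unit comes from
  the strict triple bound or, in an arithmetic progression, from a second old sum.\<close>

lemma excess_quadruple_le:
  assumes "p < q" "q < r" "r < x"
  shows "excess {p, q, r, x} \<le> 0"
proof -
  let ?S = "{p, q, r}"
  let ?N = "{y \<in> ?S. x - y \<in> diffset ?S}" and ?M = "{y \<in> ?S. x + y \<in> sumset ?S}"
  have ins: "{p, q, r, x} = insert x ?S" by auto
  have e: "excess {p, q, r, x} \<le> excess ?S + 1 - 3 - int (card ?M) + 2 * int (card ?N)"
  proof -
    have "card ?S = 3" using assms by simp
    moreover have "y < x" if "y \<in> ?S" for y using that assms by auto
    ultimately show ?thesis
      unfolding ins using excess_insert_le[of ?S x] by fastforce
  qed
  have N: "?N \<subseteq> {q, r}" using assms by (auto simp: diffset_def)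
  then have c: "card ?N \<le> 2" using card_mono[of "{q, r}" ?N] assms by simp
  have M: "card ?N > 0 \<Longrightarrow> card ?M > 0" by (rule old_sums_nonempty) auto
  have S: "excess ?S \<le> 0" using excess_triple_le assms by blast
  consider "card ?N \<le> 1" | "card ?N = 2" "r - q \<noteq> q - p" | "card ?N = 2" "r - q = q - p"
    using c by linarith
  then show ?thesis
  proof cases
    case 1
    then show ?thesis using e S M by linarith
  next
    case 2
    then have "excess ?S \<le> -1" using excess_triple_le assms by blast
    then show ?thesis using e M 2 by linarith
  next
    case 3
    have "?N = {q, r}"
      using N 3 assms by (intro card_subset_eq) auto
    then have "x - q \<in> diffset ?S" by blast
    \<comment> \<open>Then \<open>p, q, r, x\<close> is an arithmetic progression, so two of the sums are old.\<close>
    then have "x - q = r - p" using assms 3 by (auto simp: diffset_def)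
    then have "x + p = q + r" "x + q = r + r" using 3 by auto
    then have "x + p \<in> sumset ?S" "x + q \<in> sumset ?S" unfolding sumset_def by blast+
    then have "{p, q} \<subseteq> ?M" by blast
    then have "card {p, q} \<le> card ?M" by (intro card_mono) auto
    then have "2 \<le> card ?M" using assms by simp
    then show ?thesis using e S 3 by linarith
  qed
qed

text \<open>This covers the sizes at which the insertion bound alone would still allow a tail
  element to raise the excess.\<close>

lemma excess_card_le_4:
  assumes "finite S" "card S \<le> 4"
  shows "excess S \<le> 0"
proof -
  define xs where "xs = sorted_list_of_set S"
  have S: "S = set xs" and len: "length xs \<le> 4" and sorted: "sorted_wrt (<) xs"
    using assms by (auto simp: xs_def)
  consider "xs = []" | p where "xs = [p]" | p q where "xs = [p, q]"
    | p q r where "xs = [p, q, r]" | p q r x where "xs = [p, q, r, x]"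
    using len by (cases xs rule: list.exhaust; force simp: le_Suc_eq numeral_eq_Suc length_Suc_conv)
  then show ?thesis
    using sorted excess_empty excess_singleton excess_pair_le excess_triple_le(1) excess_quadruple_le
    unfolding S by cases auto
qed

text \<open>An old difference \<open>x - y = u - v\<close> would give \<open>x \<le> y + u\<close>,
  as \<open>v\<close> is nonnegative, yet \<open>y\<close> and \<open>u\<close> both lie below half
  of \<open>x\<close>.\<close>

lemma excess_insert_gap:
  assumes fin: "finite S" and nonneg: "\<And>y. y \<in> S \<Longrightarrow> 0 \<le> y"
    and gap: "\<And>y. y \<in> S \<Longrightarrow> 2 * y < x"
  shows "excess (insert x S) \<le> excess S + 1 - int (card S)"
proof -
  have less: "y < x" if "y \<in> S" for y
    using nonneg[OF that] gap[OF that] by linarith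
  have "x - y \<notin> diffset S" if "y \<in> S" for y
  proof
    assume "x - y \<in> diffset S"
    then obtain u v where "u \<in> S" "v \<in> S" "x - y = u - v" by (auto simp: diffset_def)
    then show False using gap[of u] gap[of y] nonneg[of v] that by linarith
  qed
  then have "{y \<in> S. x - y \<in> diffset S} = {}" by blast
  then have "card {y \<in> S. x - y \<in> diffset S} = 0" by (simp only: card.empty)
  then show ?thesis using excess_insert_le[OF fin less] by linarith
qed

section \<open>Finiteness for a finite head and a sparse tail\<close>

lemma MSTD_iff_excess: "MSTD S \<longleftrightarrow> finite S \<and> excess S > 0"
  by (auto simp: MSTD_def excess_def)

text \<open>Here \<open>R\<close> is the tail and \<open>T - R\<close> the head; the assumptions
  isolate what the argument uses of the sequence. All MSTD subsets are shown to lie in one finite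
  interval.\<close>

lemma finite_MSTD_subsets:
  fixes T R :: "int set"
  assumes nonneg: "\<And>x. x \<in> T \<Longrightarrow> 0 \<le> x"
    and fin_head: "finite (T - R)"
    and head_less_tail: "\<And>x y. x \<in> R \<Longrightarrow> y \<in> T - R \<Longrightarrow> y < x"
    and old_diffs: "\<And>x S. x \<in> R \<Longrightarrow> S \<subseteq> T \<Longrightarrow> finite S \<Longrightarrow> (\<And>y. y \<in> S \<Longrightarrow> y < x)
                      \<Longrightarrow> card {y \<in> S. x - y \<in> diffset S} \<le> 2"
    and not_special: "\<And>S. S \<subseteq> T \<Longrightarrow> \<not> special_MSTD S"
  shows "finite {S. S \<subseteq> T \<and> MSTD S}"
proof -
  have excess_less: "excess S < int (card S)" if "S \<subseteq> T" "finite S" "S \<noteq> {}" for S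
  proof -
    have "card S > 0" using that by (simp add: card_gt_0_iff)
    then show ?thesis
      using not_special[OF that(1)] that(2)
      by (cases "MSTD S") (auto simp: special_MSTD_def MSTD_iff_excess excess_def)
  qed
  \<comment> \<open>With N \<le> 2, and M \<ge> 1 whenever N > 0, the change 1 - |S| - M + 2N is at
    most 4 - |S|.\<close>
  have insert_tail: "excess (insert x S) \<le> excess S"
      "card S \<ge> 6 \<Longrightarrow> excess (insert x S) \<le> excess S - 1"
    if "x \<in> R" "S \<subseteq> T" "finite S" "\<And>y. y \<in> S \<Longrightarrow> y < x" "card S \<ge> 4" for x S
  proof -
    let ?N = "{y \<in> S. x - y \<in> diffset S}" and ?M = "{y \<in> S. x + y \<in> sumset S}"
    have "excess (insert x S) \<le> excess S + 1 - int (card S) - int (card ?M) + 2 * int (card ?N)"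
      using excess_insert_le that by blast
    moreover have "card ?N \<le> 2" using old_diffs that by blast
    moreover have "card ?N > 0 \<Longrightarrow> card ?M > 0" using old_sums_nonempty that by blast
    ultimately show "excess (insert x S) \<le> excess S"
      "card S \<ge> 6 \<Longrightarrow> excess (insert x S) \<le> excess S - 1"
      using that(5) by linarith+
  qed
  have union_tail: "excess (S \<union> X) \<le> 0"
    if X: "finite X" "X \<subseteq> R \<inter> T" "\<And>x y. x \<in> X \<Longrightarrow> y \<in> S \<Longrightarrow> y < x"
      and S: "S \<subseteq> T" "finite S" "excess S \<le> 0" for S X
    using X
  proof (induction X rule: finite_linorder_max_induct)
    case empty
    then show ?case using S by simp
  next
    case (insert x X)
    have IH: "excess (S \<union> X) \<le> 0" using insert by blast
    have fin: "finite (S \<union> X)" using insert S by blast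
    show ?case
    proof (cases "card (S \<union> X) \<ge> 4")
      case True
      have "excess (insert x (S \<union> X)) \<le> excess (S \<union> X)"
        using insert S fin True by (intro insert_tail(1)) auto
      then show ?thesis using IH by simp
    next
      case False
      have "card (insert x (S \<union> X)) \<le> 4"
        using False fin by (simp add: card_insert_if)
      then show ?thesis using excess_card_le_4 fin by simp
    qed
  qed
  \<comment> \<open>The term \<open>card (T - R)\<close> covers the start \<open>X = {}\<close>. The
    12 covers unions of at most 6 elements, where the excess is below 6 and \<open>card X\<close> is
    at most 6.\<close>
  define C where "C = card (T - R) + 12"
  have card_tail: "excess (S \<union> X) \<le> int C - int (card X)"
    if X: "finite X" "X \<subseteq> R \<inter> T" and S: "S \<subseteq> T - R" for S X
    using X
  proof (induction X rule: finite_linorder_max_induct)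
    case empty
    have "finite S" "card S \<le> card (T - R)"
      using S fin_head by (auto intro: finite_subset card_mono)
    moreover have "excess S \<le> int (card S)"
      using excess_less[of S] excess_empty S \<open>finite S\<close> by (cases "S = {}") fastforce+
    ultimately show ?case by (simp add: C_def)
  next
    case (insert x X)
    have fin: "finite (S \<union> X)"
      using insert S fin_head by (meson finite_UnI finite_subset)
    have "x \<notin> X" using insert by blast
    have x: "x \<in> R" "S \<union> X \<subseteq> T" "\<And>y. y \<in> S \<union> X \<Longrightarrow> y < x"
      using insert S head_less_tail by auto
    show ?case
    proof (cases "card (S \<union> X) \<ge> 6")
      case True
      have "excess (insert x (S \<union> X)) \<le> excess (S \<union> X) - 1"
        using insert_tail(2)[OF x(1,2) fin x(3)] True by simp
      then show ?thesis using insert \<open>x \<notin> X\<close> by simp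
    next
      case False
      have "card (insert x (S \<union> X)) \<le> 6"
        using False fin by (simp add: card_insert_if)
      moreover have "card (insert x X) \<le> card (insert x (S \<union> X))"
        using fin by (intro card_mono) auto
      moreover have "excess (insert x (S \<union> X)) < int (card (insert x (S \<union> X)))"
        using insert x fin by (intro excess_less) auto
      ultimately show ?thesis by (simp add: C_def)
    qed
  qed
  \<comment> \<open>Inserting 0 covers an empty head and keeps \<open>B\<close> nonnegative, as the
    later multiplications by \<open>B\<close> require.\<close>
  obtain B where B: "\<And>y. y \<in> T - R \<Longrightarrow> y \<le> B" "B \<ge> 0"
  proof
    show "y \<le> Max (insert 0 (T - R))" if "y \<in> T - R" for y
      using that fin_head by (intro Max_ge) auto
    show "Max (insert 0 (T - R)) \<ge> 0" using fin_head by (intro Max_ge) auto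
  qed
  have "S \<subseteq> {0 .. 2 ^ C * B}" if S: "S \<subseteq> T" "MSTD S" for S
  proof -
    have fin: "finite S" and pos: "excess S > 0" using S by (auto simp: MSTD_iff_excess)
    have no_gap: "\<exists>y\<in>S. y < x \<and> x \<le> 2 * y" if x: "x \<in> S" "x \<in> R" for x
    proof (rule ccontr)
      assume gap: "\<not> ?thesis"
      define L where "L = {y \<in> S. y < x}"
      have L: "L \<subseteq> T" "finite L" using S fin by (auto simp: L_def)
      have "excess (insert x L) \<le> 0"
      proof (cases "L = {}")
        case True
        then show ?thesis by (simp add: excess_singleton)
      next
        case False
        \<comment> \<open>The loss \<open>card L - 1\<close> cancels all the excess that the
          nonempty, non-special set \<open>L\<close> can have.\<close>
        have "excess (insert x L) \<le> excess L + 1 - int (card L)"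
          using L nonneg gap by (intro excess_insert_gap) (auto simp: L_def not_le)
        then show ?thesis using excess_less[OF L False] by linarith
      qed
      \<comment> \<open>Everything in \<open>S\<close> above \<open>x\<close> is tail, so
        \<open>union_tail\<close> carries the nonpositive excess up to \<open>S\<close>.\<close>
      moreover have "{y \<in> S. x < y} \<subseteq> R"
        using head_less_tail[OF x(2)] S by force
      ultimately have "excess (insert x L \<union> {y \<in> S. x < y}) \<le> 0"
        using L S x fin by (intro union_tail) (auto simp: L_def)
      moreover have "insert x L \<union> {y \<in> S. x < y} = S" using x by (auto simp: L_def)
      ultimately show False using pos by simp
    qed
    define X where "X = S \<inter> R"
    have "finite X" using fin by (simp add: X_def)
    have "(S - R) \<union> X = S" by (auto simp: X_def)
    moreover have "X \<subseteq> R \<inter> T" "S - R \<subseteq> T - R" using S by (auto simp: X_def)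
    ultimately have "card X \<le> C"
      using card_tail[of X "S - R"] \<open>finite X\<close> pos by auto
    \<comment> \<open>Descend from \<open>x\<close> by \<open>no_gap\<close> until the head is
      reached: each step at most halves the value and removes at least one tail element from the
      count in the exponent.\<close>
    have bound: "x \<le> 2 ^ card {y \<in> X. y \<le> x} * B" if "x \<in> S" for x
      using that
    proof (induction "card {y \<in> S. y < x}" arbitrary: x rule: less_induct)
      case less
      show ?case
      proof (cases "x \<in> R")
        case False
        then have "x \<le> 1 * B" using B less.prems S by auto
        also have "\<dots> \<le> 2 ^ card {y \<in> X. y \<le> x} * B"
          using B(2) by (intro mult_right_mono) auto
        finally show ?thesis .
      next
        case True
        then obtain y where y: "y \<in> S" "y < x" "x \<le> 2 * y"
          using no_gap less.prems by blast
        have "card {z \<in> S. z < y} < card {z \<in> S. z < x}"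
          using y fin by (intro psubset_card_mono) auto
        then have "y \<le> 2 ^ card {z \<in> X. z \<le> y} * B" using less y by blast
        then have "x \<le> 2 ^ Suc (card {z \<in> X. z \<le> y}) * B" using y by simp
        also have "\<dots> \<le> 2 ^ card {z \<in> X. z \<le> x} * B"
        proof (intro mult_right_mono power_increasing Suc_leI psubset_card_mono)
          have "x \<in> X" using True less.prems by (simp add: X_def)
          then have "x \<in> {z \<in> X. z \<le> x} - {z \<in> X. z \<le> y}" using y by simp
          moreover have "{z \<in> X. z \<le> y} \<subseteq> {z \<in> X. z \<le> x}" using y by auto
          ultimately show "{z \<in> X. z \<le> y} \<subset> {z \<in> X. z \<le> x}" by blast
        qed (use \<open>finite X\<close> B in auto)
        finally show ?thesis .
      qed
    qed
    have "x \<le> 2 ^ C * B" if "x \<in> S" for x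
    proof -
      have "card {y \<in> X. y \<le> x} \<le> C"
        using \<open>card X \<le> C\<close> card_mono[OF \<open>finite X\<close>, of "{y \<in> X. y \<le> x}"] by auto
      then have "2 ^ card {y \<in> X. y \<le> x} * B \<le> 2 ^ C * B"
        using B(2) by (intro mult_right_mono power_increasing) auto
      then show ?thesis using bound[OF that] by linarith
    qed
    then show ?thesis using nonneg S by auto
  qed
  then have "{S. S \<subseteq> T \<and> MSTD S} \<subseteq> Pow {0 .. 2 ^ C * B}" by blast
  then show ?thesis by (rule finite_subset) simp
qed

section \<open>Application to the sequence\<close>

text \<open>The first terms need not be ordered, but eventually every term is a record.\<close>

lemma eventually_records:
  fixes a :: "nat \<Rightarrow> nat"
  assumes "\<And>k. k \<ge> m \<Longrightarrow> a k < a (Suc k)"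
  obtains t where "t \<ge> m" "\<And>j k. t \<le> k \<Longrightarrow> j \<le> k \<Longrightarrow> a j \<le> a k"
proof
  \<comment> \<open>Strict increase gives \<open>i \<le> a (m + i)\<close>, so from index
    \<open>m + B\<close> on the terms have caught up with the maximum \<open>B\<close> of the
    initial ones.\<close>
  define B where "B = Max (a ` {..m})"
  show "m + B \<ge> m" by simp
  have mono: "a j \<le> a k" if "m \<le> j" "j \<le> k" for j k
    using that(2,1)
  proof (induction k rule: dec_induct)
    case (step k)
    then show ?case using assms[of k] by simp
  qed simp
  have grow: "i \<le> a (m + i)" for i
    by (induction i) (use assms in \<open>auto simp: Suc_le_eq intro: le_less_trans\<close>)
  show "a j \<le> a k" if "m + B \<le> k" "j \<le> k" for j k
  proof (cases "j \<le> m")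
    case True
    then have "a j \<le> B" by (auto simp: B_def)
    also have "\<dots> \<le> a (m + B)" by (rule grow)
    also have "\<dots> \<le> a k" using that by (intro mono) auto
    finally show ?thesis .
  next
    case False
    then show ?thesis using that mono by simp
  qed
qed

theorem theorem1p3:
  fixes a :: "nat \<Rightarrow> nat"
  assumes "\<exists>s::int.
      (\<forall>k::nat. k \<ge> 4 \<and> int k \<ge> s \<longrightarrow> a k > a (k - 1) + a (k - 3)) \<and>
      \<not> (\<exists>S. S \<subseteq> seq_terms a \<and> special_MSTD S)"
  shows "finite {S. S \<subseteq> seq_terms a \<and> MSTD S}"
proof -
  obtain s :: int where growth: "\<And>k. k \<ge> 4 \<Longrightarrow> int k \<ge> s \<Longrightarrow> a k > a (k - 1) + a (k - 3)"
    and not_special: "\<And>S. S \<subseteq> seq_terms a \<Longrightarrow> \<not> special_MSTD S"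
    using assms by blast
  \<comment> \<open>The growth condition is assumed only from index 4 on, where \<open>k - 3\<close>
    is still a genuine index; \<open>nat s\<close> turns a negative \<open>s\<close> into 0.\<close>
  define m where "m = max 4 (nat s)"
  have "a k < a (Suc k)" if "k \<ge> m" for k
  proof -
    have "int (Suc k) \<ge> s" using that by (simp add: m_def) linarith
    then show ?thesis using growth[of "Suc k"] that by (simp add: m_def)
  qed
  then obtain t where t: "t \<ge> m" and rec: "\<And>j k. t \<le> k \<Longrightarrow> j \<le> k \<Longrightarrow> a j \<le> a k"
    using eventually_records by blast
  have step: "a k > a (k - 1) + a (k - 3)" if "k \<ge> t" for k
  proof -
    have "int k \<ge> s" using that t by (simp add: m_def) linarith
    then show ?thesis using growth[of k] that t by (simp add: m_def)
  qed
  \<comment> \<open>Starting at \<open>t + 3\<close> makes \<open>k - 1\<close>,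
    \<open>k - 2\<close> and \<open>k - 3\<close> all at least \<open>t\<close>, so that
    \<open>rec\<close> applies to them.\<close>
  define R where "R = (\<lambda>k. int (a k)) ` {t + 3..}"
  show ?thesis
  proof (rule finite_MSTD_subsets[where R = R])
    show "0 \<le> x" if "x \<in> seq_terms a" for x
      using that by (auto simp: seq_terms_def)
    have head: "\<exists>j < t + 3. y = int (a j)" if "y \<in> seq_terms a - R" for y
      using that by (force simp: seq_terms_def R_def not_le)
    then have "seq_terms a - R \<subseteq> (\<lambda>k. int (a k)) ` {..<t + 3}" by blast
    then show "finite (seq_terms a - R)" by (rule finite_subset) simp
    show "y < x" if "x \<in> R" "y \<in> seq_terms a - R" for x y
    proof -
      obtain j where j: "j < t + 3" "y = int (a j)" using head \<open>y \<in> seq_terms a - R\<close> by blast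
      obtain k where k: "k \<ge> t + 3" "x = int (a k)" using \<open>x \<in> R\<close> by (auto simp: R_def)
      have "a j \<le> a (k - 1)" using j k by (intro rec) auto
      also have "\<dots> < a k" using step[of k] k by simp
      finally show ?thesis using j k by simp
    qed
    show "card {y \<in> S. x - y \<in> diffset S} \<le> 2"
      if x: "x \<in> R" and S: "S \<subseteq> seq_terms a" "finite S" and less: "\<And>y. y \<in> S \<Longrightarrow> y < x" for x S
    proof -
      obtain k where k: "k \<ge> t + 3" "x = int (a k)" using x by (auto simp: R_def)
      have index: "\<exists>j < k. y = int (a j)" if y: "y \<in> S" for y
      proof -
        obtain j where j: "y = int (a j)" using y S by (auto simp: seq_terms_def)
        have "j < k"
        proof (rule ccontr)
          assume "\<not> j < k"
          then have "a k \<le> a j" using k by (intro rec) auto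
          then show False using less[OF y] j k by simp
        qed
        with j show ?thesis by blast
      qed
      \<comment> \<open>From \<open>x - y = u - v \<le> u \<le> a (k - 1)\<close> and the growth
        condition, \<open>y\<close> exceeds \<open>a (k - 3)\<close>, hence its index exceeds
        \<open>k - 3\<close>.\<close>
      have "y \<in> {int (a (k - 1)), int (a (k - 2))}" if y: "y \<in> S" "x - y \<in> diffset S" for y
      proof -
        obtain u v where uv: "u \<in> S" "v \<in> S" "x - y = u - v"
          using y by (auto simp: diffset_def)
        obtain i where i: "i < k" "u = int (a i)" using index uv by blast
        obtain j where j: "j < k" "y = int (a j)" using index y by blast
        have "v \<ge> 0" using uv S by (auto simp: seq_terms_def)
        have "a i \<le> a (k - 1)" using i k by (intro rec) auto
        then have "y > int (a (k - 3))"
          using step[of k] k uv i \<open>v \<ge> 0\<close> by linarith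
        moreover have "a j \<le> a (k - 3)" if "j \<le> k - 3"
          using that k by (intro rec) auto
        ultimately have "\<not> j \<le> k - 3" using j by auto
        then have "j = k - 1 \<or> j = k - 2" using j by linarith
        then show ?thesis using j by blast
      qed
      then have "{y \<in> S. x - y \<in> diffset S} \<subseteq> {int (a (k - 1)), int (a (k - 2))}" by blast
      then have "card {y \<in> S. x - y \<in> diffset S} \<le> card {int (a (k - 1)), int (a (k - 2))}"
        by (intro card_mono) auto
      also have "\<dots> \<le> 2" by (simp add: card_insert_if)
      finally show ?thesis .
    qed
  qed (use not_special in blast)
qed

end
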